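(* Let $r\geq 2$, $0<c\leq 1/2$, let $H$ be a graph with vertex set $\{v_1,\ldots,v_r\}$, and let $G$ be a graph of order $n$. If $G$ contains more than $cn^{r}$ induced copies of $H$, then $G$ contains an induced subgraph of type $H(s,\ldots,s,t)$, where $s=\lfloor c^{r^{2}}\ln n\rfloor$ and $t$ is an integer with $t>n^{1-c^{r-1}}$.
   Context: For a graph $H$ with vertices $v_1,\ldots,v_r$ and positive integers $x_1,\ldots,x_r$, $H(x_1,\ldots,x_r)$ denotes the graph obtained by replacing each vertex $v_i$ with a set $V_{v_i}$ of $x_i$ vertices (the sets pairwise disjoint, each independent) and each edge $v_iv_j\in E(H)$ with a complete bipartite graph between $V_{v_i}$ and $V_{v_j}$. A graph $X$ is of type $H(x_1,\ldots,x_r)$ if $X$ is obtained from $H(x_1,\ldots,x_r)$ by adding some edges within the sets $V_{v_i}$ (so between different classes $V_{v_i},V_{v_j}$ there are all edges if $v_iv_j\in E(H)$ and no edges otherwise). In $H(s,\ldots,s,t)$ the classes of $v_1,\ldots,v_{r-1}$ have size $s$ and the class of $v_r$ has size $t$. $\ln$ is the natural logarithm. *)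

theory Defs
  imports Complex_Main
begin

definition simple_graph :: "'a set \<Rightarrow> ('a \<Rightarrow> 'a \<Rightarrow> bool) \<Rightarrow> bool" where
  "simple_graph V E \<longleftrightarrow> finite V \<and> (\<forall>x\<in>V. \<forall>y\<in>V. E x y \<longleftrightarrow> E y x) \<and> (\<forall>x\<in>V. \<not> E x x)"

text \<open>The graph H has vertex set {0..<r}; index i stands for v_(i+1).
  An induced copy of H in G is an r-element vertex set S of G whose induced
  subgraph is isomorphic to H.\<close>
definition induced_copies ::
  "'a set \<Rightarrow> ('a \<Rightarrow> 'a \<Rightarrow> bool) \<Rightarrow> nat \<Rightarrow> (nat \<Rightarrow> nat \<Rightarrow> bool) \<Rightarrow> 'a set set" where
  "induced_copies V E r EH = {S. S \<subseteq> V \<and> (\<exists>f. bij_betw f {0..<r} S \<and>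
       (\<forall>i<r. \<forall>j<r. i \<noteq> j \<longrightarrow> (E (f i) (f j) \<longleftrightarrow> EH i j)))}"

definition has_induced_type ::
  "'a set \<Rightarrow> ('a \<Rightarrow> 'a \<Rightarrow> bool) \<Rightarrow> nat \<Rightarrow> (nat \<Rightarrow> nat \<Rightarrow> bool) \<Rightarrow> (nat \<Rightarrow> nat) \<Rightarrow> bool" where
  "has_induced_type V E r EH x \<longleftrightarrow> (\<exists>U :: nat \<Rightarrow> 'a set.
      (\<forall>i<r. U i \<subseteq> V \<and> finite (U i) \<and> card (U i) = x i) \<and>
      (\<forall>i<r. \<forall>j<r. i \<noteq> j \<longrightarrow> U i \<inter> U j = {}) \<and>
      (\<forall>i<r. \<forall>j<r. i \<noteq> j \<longrightarrow> (\<forall>a\<in>U i. \<forall>b\<in>U j. E a b \<longleftrightarrow> EH i j)))"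

end

theory Submission
  imports Defs
begin

text \<open>
  Encode induced copies of \<open>H\<close> as \<open>r\<close>-tuples, and call an \<open>(r-1)\<close>-tuple rich if it has at
  least \<open>cn/2\<close> extensions; the rich tuples have density at least \<open>c/2\<close>. By induction they
  contain \<open>m\<close> pairwise disjoint members (\<open>m\<close> about \<open>4s/c\<close>, a small multiple of \<open>ln n\<close>) such
  that coordinates of different members are also related as prescribed by \<open>H\<close>. In the bipartite
  graph between these \<open>m\<close> tuples and \<open>V\<close>, at least \<open>cn/4\<close> vertices extend \<open>s\<close> or more of the
  tuples. There are only \<open>2 ^ m\<close> sets of tuples, so some \<open>s\<close> tuples have more than
  \<open>n powr (1 - c ^ (r-1))\<close> common extensions. Working with a family of disjoint tuples, instead
  of with the \<open>r\<close>-uniform hypergraph of copies, is what keeps \<open>s\<close> linear in \<open>ln n\<close>.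
\<close>

section \<open>Double counting and pigeonhole in a dense bipartite graph\<close>

text \<open>By double counting, at least \<open>\<delta> / 2 * card B\<close> elements of
  \<open>B\<close> have \<open>s\<close> or more neighbours in \<open>A\<close>. Choosing
  \<open>s\<close> neighbours for each and applying pigeonhole over the \<open>2 ^ card A\<close>
  subsets of \<open>A\<close> gives one \<open>S\<close> chosen by all of \<open>T\<close>.\<close>

lemma popular_subset_exists:
  fixes P :: "'a \<Rightarrow> 'b \<Rightarrow> bool" and \<delta> :: real
  assumes A: "finite A" "A \<noteq> {}" and B: "finite B" "B \<noteq> {}" and \<delta>: "0 < \<delta>"
    and deg: "\<And>a. a \<in> A \<Longrightarrow> \<delta> * card B \<le> card {b \<in> B. P a b}"
    and s: "real s - 1 \<le> \<delta> / 2 * card A"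
  shows "\<exists>S T. S \<subseteq> A \<and> card S = s \<and> T \<subseteq> B \<and> (\<forall>a\<in>S. \<forall>b\<in>T. P a b)
    \<and> \<delta> / 2 * card B \<le> real (card T) * 2 ^ card A"
proof -
  define B' where "B' = {b \<in> B. s \<le> card {a \<in> A. P a b}}"
  have finB': "finite B'" and subB': "B' \<subseteq> B" using B by (auto simp: B'_def)
  have posA: "0 < real (card A)" using A by (simp add: card_gt_0_iff)
  have posB: "0 < real (card B)" using B by (simp add: card_gt_0_iff)
  have "\<delta> * card B * card A = (\<Sum>a\<in>A. \<delta> * card B)" by simp
  also have "\<dots> \<le> (\<Sum>a\<in>A. real (card {b \<in> B. P a b}))" by (rule sum_mono) (rule deg)
  also have "\<dots> = real (\<Sum>b\<in>B. card {a \<in> A. P a b})"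
    using sum_multicount_gen[OF A(1) B(1), of P "\<lambda>b. card {a \<in> A. P a b}"]
    by (simp flip: of_nat_sum)
  \<comment> \<open>An unpopular \<open>b\<close> has at most \<open>s - 1\<close> neighbours, hence
    at most \<open>\<delta> / 2 * card A\<close>: this integrality is why the size hypothesis is
    stated with \<open>real s - 1\<close>.\<close>
  also have "\<dots> \<le> (\<Sum>b\<in>B. (if b \<in> B' then real (card A) else 0) + \<delta> / 2 * card A)"
    unfolding of_nat_sum
  proof (rule sum_mono)
    fix b assume b: "b \<in> B"
    have le: "card {a \<in> A. P a b} \<le> card A" by (rule card_mono) (use A in auto)
    have "0 \<le> \<delta> / 2 * card A" using \<delta> by simp
    moreover have "real (card {a \<in> A. P a b}) \<le> real s - 1" if "b \<notin> B'"
      using that b by (auto simp: B'_def)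
    ultimately show "real (card {a \<in> A. P a b})
        \<le> (if b \<in> B' then real (card A) else 0) + \<delta> / 2 * card A"
      using le s by fastforce
  qed
  also have "\<dots> = card B' * card A + card B * (\<delta> / 2 * card A)"
  proof -
    have "(\<Sum>b\<in>B. if b \<in> B' then real (card A) else 0) = (\<Sum>b\<in>B'. real (card A))"
      by (rule sum.mono_neutral_cong_right) (use B subB' in auto)
    then show ?thesis by (simp add: sum.distrib)
  qed
  finally have "(\<delta> / 2 * card B) * card A \<le> card B' * card A"
    by (simp add: field_simps)
  then have B'_large: "\<delta> / 2 * card B \<le> card B'" using posA by simp
  have "\<exists>f. \<forall>b\<in>B'. f b \<subseteq> {a \<in> A. P a b} \<and> card (f b) = s"
  proof (rule bchoice, rule ballI)
    fix b assume "b \<in> B'"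
    then have "s \<le> card {a \<in> A. P a b}" by (simp add: B'_def)
    then show "\<exists>S. S \<subseteq> {a \<in> A. P a b} \<and> card S = s"
      by (metis obtain_subset_with_card_n)
  qed
  then obtain f where f: "\<And>b. b \<in> B' \<Longrightarrow> f b \<subseteq> {a \<in> A. P a b}" "\<And>b. b \<in> B' \<Longrightarrow> card (f b) = s"
    by blast
  have "\<exists>S\<in>Pow A. card B' \<le> card {b \<in> B'. f b = S} * 2 ^ card A"
  proof (rule ccontr)
    assume "\<not> ?thesis"
    then have small: "card {b \<in> B'. f b = S} * 2 ^ card A < card B'" if "S \<in> Pow A" for S
      using that not_le by blast
    have "card B' = card (\<Union>S\<in>Pow A. {b \<in> B'. f b = S})"
      by (rule arg_cong[of _ _ card]) (use f in blast)
    also have "\<dots> \<le> (\<Sum>S\<in>Pow A. card {b \<in> B'. f b = S})"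
      by (rule card_UN_le) (use A in simp)
    finally have "card B' * 2 ^ card A \<le> (\<Sum>S\<in>Pow A. card {b \<in> B'. f b = S} * 2 ^ card A)"
      by (simp flip: sum_distrib_right)
    also have "\<dots> < (\<Sum>S\<in>Pow A. card B')"
      by (rule sum_strict_mono) (use A small in auto)
    also have "\<dots> = card B' * 2 ^ card A" using A by (simp add: card_Pow)
    finally show False by simp
  qed
  then obtain S where S: "S \<subseteq> A" "card B' \<le> card {b \<in> B'. f b = S} * 2 ^ card A" by blast
  define T where "T = {b \<in> B'. f b = S}"
  \<comment> \<open>Nonemptiness of \<open>T\<close> is what forces \<open>card S = s\<close>, since
    \<open>S\<close> must be a value of \<open>f\<close> on \<open>B'\<close>.\<close>
  have "0 < real (card B')" using B'_large posB \<delta> by (smt (verit) divide_pos_pos mult_pos_pos)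
  then have "T \<noteq> {}" using S(2) unfolding T_def by (metis card.empty mult_zero_left not_less of_nat_0_less_iff)
  then have "card S = s" using f(2) by (auto simp: T_def)
  moreover have "\<forall>a\<in>S. \<forall>b\<in>T. P a b" using f(1) by (auto simp: T_def)
  moreover have "T \<subseteq> B" using subB' by (auto simp: T_def)
  moreover have "\<delta> / 2 * card B \<le> real (card T) * 2 ^ card A"
  proof -
    have "real (card B') \<le> real (card T * 2 ^ card A)" using S(2) unfolding T_def of_nat_le_iff .
    then show ?thesis using B'_large by simp
  qed
  ultimately show ?thesis using S(1) by blast
qed

section \<open>Tuples, joint families and prefixes with many extensions\<close>

definition tuples :: "'a set \<Rightarrow> nat \<Rightarrow> 'a list set" where
  "tuples V j = {xs. set xs \<subseteq> V \<and> length xs = j}"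

text \<open>\<open>R i k\<close> is the relation prescribed between positions \<open>i\<close> and
  \<open>k\<close>. Equal positions are left unconstrained because edges inside a class are
  arbitrary. For the relation induced by \<open>EH\<close>, \<open>compatible R xs xs\<close> makes
  \<open>xs\<close> an ordered induced copy.\<close>

definition compatible ::
  "(nat \<Rightarrow> nat \<Rightarrow> 'a \<Rightarrow> 'a \<Rightarrow> bool) \<Rightarrow> 'a list \<Rightarrow> 'a list \<Rightarrow> bool" where
  "compatible R xs ys \<longleftrightarrow>
     (\<forall>i<length xs. \<forall>k<length ys. i \<noteq> k \<longrightarrow> R i k (xs ! i) (ys ! k))"

text \<open>The \<open>i\<close>-th coordinates of the members are to form the \<open>i\<close>-th
  class; the inequality at equal positions gives that class as many vertices as there are
  tuples.\<close>

definition joint :: "(nat \<Rightarrow> nat \<Rightarrow> 'a \<Rightarrow> 'a \<Rightarrow> bool) \<Rightarrow> 'a list set \<Rightarrow> bool" where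
  "joint R F \<longleftrightarrow> (\<forall>xs\<in>F. \<forall>ys\<in>F. compatible R xs ys \<and>
     (xs \<noteq> ys \<longrightarrow> (\<forall>i<length xs. xs ! i \<noteq> ys ! i)))"

definition rich_prefixes :: "'a set \<Rightarrow> nat \<Rightarrow> 'a list set \<Rightarrow> real \<Rightarrow> 'a list set" where
  "rich_prefixes V j X \<delta> = {xs \<in> tuples V j. \<delta> * card V \<le> card {v \<in> V. xs @ [v] \<in> X}}"

lemma finite_tuples: "finite V \<Longrightarrow> finite (tuples V j)"
  by (simp add: tuples_def finite_lists_length_eq)

lemma card_tuples: "finite V \<Longrightarrow> card (tuples V j) = card V ^ j"
  by (simp add: tuples_def card_lists_length_eq)

lemma joint_subset: "joint R F \<Longrightarrow> G \<subseteq> F \<Longrightarrow> joint R G"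
  by (auto simp: joint_def)

lemma compatible_prefix: "compatible R (xs @ [v]) (ys @ [w]) \<Longrightarrow> compatible R xs ys"
  unfolding compatible_def
  by (metis length_append_singleton less_SucI nth_append)

text \<open>Prefixes that are not rich account for at most
  \<open>\<delta> * real (card V) ^ Suc j\<close> tuples, half of the guaranteed number. Each rich
  prefix has at most \<open>card V\<close> extensions, so the other half bounds their number from
  below.\<close>

lemma card_rich_prefixes:
  assumes V: "finite V" "V \<noteq> {}" and \<delta>: "0 \<le> \<delta>" and X: "X \<subseteq> tuples V (Suc j)"
    and dens: "2 * \<delta> * real (card V) ^ Suc j \<le> card X"
  shows "\<delta> * real (card V) ^ j \<le> card (rich_prefixes V j X \<delta>)"
proof -
  let ?n = "card V" and ?Y = "rich_prefixes V j X \<delta>"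
  let ?ext = "\<lambda>xs. {v \<in> V. xs @ [v] \<in> X}"
  have pos: "0 < real ?n" using V by (simp add: card_gt_0_iff)
  have "X \<subseteq> (\<Union>xs\<in>tuples V j. (\<lambda>v. xs @ [v]) ` ?ext xs)"
  proof
    fix ys assume ys: "ys \<in> X"
    with X have "ys \<noteq> []" "set ys \<subseteq> V" "length ys = Suc j" by (auto simp: tuples_def)
    moreover from this have "butlast ys @ [last ys] = ys" by simp
    moreover have "butlast ys \<in> tuples V j"
      using calculation by (auto simp: tuples_def dest: in_set_butlastD)
    ultimately show "ys \<in> (\<Union>xs\<in>tuples V j. (\<lambda>v. xs @ [v]) ` ?ext xs)"
      using ys by (intro UN_I[of "butlast ys"] image_eqI[of _ _ "last ys"]) auto
  qed
  then have "card X \<le> card (\<Union>xs\<in>tuples V j. (\<lambda>v. xs @ [v]) ` ?ext xs)"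
    by (rule card_mono[rotated]) (use V in \<open>auto simp: finite_tuples\<close>)
  also have "\<dots> \<le> (\<Sum>xs\<in>tuples V j. card ((\<lambda>v. xs @ [v]) ` ?ext xs))"
    by (rule card_UN_le) (use V in \<open>simp add: finite_tuples\<close>)
  also have "\<dots> \<le> (\<Sum>xs\<in>tuples V j. card (?ext xs))"
    by (rule sum_mono) (use V in \<open>simp add: card_image_le\<close>)
  finally have "real (card X) \<le> (\<Sum>xs\<in>tuples V j. real (card (?ext xs)))"
    by (simp only: flip: of_nat_sum of_nat_le_iff[where 'a = real])
  also have "\<dots> \<le> (\<Sum>xs\<in>tuples V j. (if xs \<in> ?Y then real ?n else 0) + \<delta> * ?n)"
  proof (rule sum_mono)
    fix xs assume "xs \<in> tuples V j"
    moreover have "card (?ext xs) \<le> ?n" by (rule card_mono) (use V in auto)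
    moreover have "0 \<le> \<delta> * ?n" using \<delta> by simp
    ultimately show "real (card (?ext xs)) \<le> (if xs \<in> ?Y then real ?n else 0) + \<delta> * ?n"
      by (auto simp: rich_prefixes_def)
  qed
  also have "\<dots> = card ?Y * ?n + real ?n ^ j * (\<delta> * ?n)"
  proof -
    have "(\<Sum>xs\<in>tuples V j. if xs \<in> ?Y then real ?n else 0) = (\<Sum>xs\<in>?Y. real ?n)"
      by (rule sum.mono_neutral_cong_right)
        (use V in \<open>auto simp: finite_tuples rich_prefixes_def\<close>)
    then show ?thesis using V by (simp add: sum.distrib card_tuples)
  qed
  finally have "(\<delta> * real ?n ^ j) * ?n \<le> card ?Y * ?n"
    using dens by (simp add: algebra_simps)
  then show ?thesis using pos by simp
qed

lemma rich_prefix_compatible: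
  assumes "V \<noteq> {}" "finite V" "0 < \<delta>" "\<And>xs. xs \<in> X \<Longrightarrow> compatible R xs xs"
    and "xs \<in> rich_prefixes V j X \<delta>"
  shows "compatible R xs xs"
proof -
  have "0 < \<delta> * card V" using assms by (simp add: card_gt_0_iff)
  then have "0 < real (card {v \<in> V. xs @ [v] \<in> X})"
    using assms(5) by (simp add: rich_prefixes_def)
  then have "{v \<in> V. xs @ [v] \<in> X} \<noteq> {}" by (metis card.empty of_nat_0 less_irrefl)
  then obtain v where "xs @ [v] \<in> X" by blast
  then show ?thesis using assms(4) compatible_prefix by metis
qed

text \<open>Every vertex of \<open>T\<close> extends every tuple of \<open>S\<close>, so the vertex
  appended to one tuple is also correctly related to the coordinates of all the others. Injectivity
  of \<open>g\<close> separates the new coordinates.\<close>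

lemma joint_append_distinct:
  assumes S: "joint R S" "S \<subseteq> tuples V j"
    and ST: "\<And>xs v. xs \<in> S \<Longrightarrow> v \<in> T \<Longrightarrow> compatible R (xs @ [v]) (xs @ [v])"
    and g: "inj_on g S" "g ` S \<subseteq> T"
  shows "joint R ((\<lambda>xs. xs @ [g xs]) ` S)"
proof -
  have len: "length xs = j" if "xs \<in> S" for xs using S(2) that by (auto simp: tuples_def)
  have "compatible R (xs @ [g xs]) (ys @ [g ys])" if xs: "xs \<in> S" and ys: "ys \<in> S" for xs ys
    unfolding compatible_def
  proof (intro allI impI)
    fix i k assume ik: "i < length (xs @ [g xs])" "k < length (ys @ [g ys])" "i \<noteq> k"
    have "compatible R xs ys" using S(1) xs ys by (auto simp: joint_def)
    then have 1: "R i k (xs ! i) (ys ! k)" if "i < j" "k < j"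
      using that ik len xs ys by (auto simp: compatible_def)
    have "compatible R (xs @ [g ys]) (xs @ [g ys])" using ST g xs ys by blast
    then have 2: "R i j (xs ! i) (g ys)" if "i < j"
      using that len[OF xs] unfolding compatible_def
      by (metis length_append_singleton less_Suc_eq nat_neq_iff nth_append nth_append_length)
    have "compatible R (ys @ [g xs]) (ys @ [g xs])" using ST g xs ys by blast
    then have 3: "R j k (g xs) (ys ! k)" if "k < j"
      using that len[OF ys] unfolding compatible_def
      by (metis length_append_singleton less_Suc_eq nat_neq_iff nth_append nth_append_length)
    show "R i k ((xs @ [g xs]) ! i) ((ys @ [g ys]) ! k)"
      using ik 1 2 3 len[OF xs] len[OF ys] by (auto simp: nth_append less_Suc_eq)
  qed
  moreover have "(xs @ [g xs]) ! i \<noteq> (ys @ [g ys]) ! i"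
    if "xs \<in> S" "ys \<in> S" "xs \<noteq> ys" "i < Suc j" for xs ys i
    using that S(1) g len by (auto simp: joint_def nth_append less_Suc_eq inj_on_def)
  ultimately show ?thesis using len by (auto simp: joint_def)
qed

text \<open>The bipartite graph joins a prefix to the vertices extending it. This serves both the
  inductive step and the final choice of the large class.\<close>

lemma joint_large_extension:
  assumes V: "finite V" "V \<noteq> {}" and F: "F \<subseteq> rich_prefixes V j X \<delta>" "F \<noteq> {}"
    and \<delta>: "0 < \<delta>" and s: "real s - 1 \<le> \<delta> / 2 * card F"
  shows "\<exists>S T. S \<subseteq> F \<and> card S = s \<and> T \<subseteq> V \<and> (\<forall>xs\<in>S. \<forall>v\<in>T. xs @ [v] \<in> X)
    \<and> \<delta> / 2 * card V \<le> real (card T) * 2 ^ card F"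
proof (rule popular_subset_exists)
  show "finite F"
    using F finite_tuples[OF V(1), of j] by (auto simp: rich_prefixes_def intro: finite_subset)
qed (use assms in \<open>auto simp: rich_prefixes_def\<close>)

section \<open>Numerical estimates\<close>

text \<open>\<open>m\<close> is the family size from which \<open>s\<close> members with many common
  extensions can be extracted. Rounding down costs at most \<open>\<delta> / 2\<close>, which the
  slack in \<open>real s - 1\<close> absorbs.\<close>

lemma floor_quotient_bound:
  assumes "0 < \<delta>" "\<delta> \<le> 1" "1 \<le> s"
  defines "m \<equiv> nat \<lfloor>real s * 2 / \<delta>\<rfloor>"
  shows "real m \<le> real s * 2 / \<delta>" "0 < m" "real s - 1 \<le> \<delta> / 2 * real m"
proof -
  have ge: "2 \<le> real s * 2 / \<delta>" using assms by (simp add: field_simps)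
  then show "real m \<le> real s * 2 / \<delta>" "0 < m" by (auto simp: m_def)
  have "real s * 2 / \<delta> - 1 \<le> real m" using ge unfolding m_def by linarith
  then have "\<delta> / 2 * (real s * 2 / \<delta> - 1) \<le> \<delta> / 2 * real m"
    using assms by (intro mult_left_mono) auto
  moreover have "\<delta> / 2 * (real s * 2 / \<delta> - 1) = real s - \<delta> / 2"
    using assms by (simp add: field_simps)
  ultimately show "real s - 1 \<le> \<delta> / 2 * real m" using assms by linarith
qed

text \<open>\<open>7 / 10\<close> is a rational upper bound for \<open>ln 2\<close>. The quadratic
  Taylor bound at \<open>7 / 10\<close> itself falls short of 2, so it is applied at a quarter of
  the argument and raised to the fourth power.\<close>

lemma two_le_exp: "2 \<le> exp (7 / 10 :: real)"
proof -
  have "119 / 100 \<le> exp (7 / 40 :: real)"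
    using exp_lower_Taylor_quadratic[of "7 / 40 :: real"] by (simp add: power2_eq_square)
  then have "(119 / 100) ^ 4 \<le> exp (7 / 40 :: real) ^ 4" by (intro power_mono) auto
  moreover have "exp (7 / 40 :: real) ^ 4 = exp (7 / 10)"
    by (simp flip: exp_of_nat_mult)
  ultimately show ?thesis by (simp add: eval_nat_numeral)
qed

lemma two_power_le_exp: "2 ^ m \<le> exp (7 / 10 * real m)"
  using power_mono[OF two_le_exp, of m] by (simp add: mult.commute flip: exp_of_nat_mult)

lemma le_exp_half: "L \<le> exp (L / 2)" for L :: real
proof (cases "0 \<le> L")
  case True
  have "1 + L / 2 + (L / 2)\<^sup>2 / 2 \<le> exp (L / 2)"
    by (rule exp_lower_Taylor_quadratic) (use True in simp)
  moreover have "0 \<le> (L - 2)\<^sup>2" by simp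
  ultimately show ?thesis by (simp add: power2_eq_square field_simps)
next
  case False then show ?thesis by (smt (verit) exp_gt_zero)
qed

text \<open>The threshold 24 makes the quadratic term \<open>L\<^sup>2 / 32\<close> at least
  \<open>3 * L / 4\<close>.\<close>

lemma le_exp_quarter:
  fixes L :: real assumes "24 \<le> L" shows "L \<le> exp (L / 4)"
proof -
  have "1 + L / 4 + (L / 4)\<^sup>2 / 2 \<le> exp (L / 4)"
    by (rule exp_lower_Taylor_quadratic) (use assms in simp)
  moreover have "24 * L \<le> L * L" using assms by (intro mult_right_mono) auto
  ultimately show ?thesis by (simp add: power2_eq_square)
qed

text \<open>Turns the halved densities into pure powers of \<open>c\<close>, so that losses can be
  tracked in the exponent alone.\<close>

lemma dyadic_density_ge:
  fixes c :: real assumes "0 < c" "c \<le> 1/2" shows "c ^ Suc k \<le> c / 2 ^ k"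
  using power_mono[OF assms(2), of k] assms by (simp add: power_divide field_simps)

section \<open>Joint families inside dense sets of tuples\<close>

text \<open>
  Passing from length \<open>j + 2\<close> to \<open>j + 1\<close> halves the density \<open>c / 2 ^ k\<close> and multiplies the required
  size by \<open>2 ^ (k + 2) / c\<close>, which is at most \<open>(1 / c) ^ (k + 3)\<close>; the exponent
  \<open>1 + j * (k + 3) + j\<^sup>2\<close> absorbs these factors, and equals \<open>r\<^sup>2 - 3\<close> for
  \<open>j = r - 2\<close> and \<open>k = 1\<close>.
\<close>

lemma joint_exists:
  fixes c L :: real
  assumes V: "finite V" and c: "0 < c" "c \<le> 1/2"
    and L: "L = ln (card V)" "1 \<le> c ^ (r\<^sup>2) * L"
  shows "\<lbrakk>1 \<le> k; Suc j + k \<le> r; X \<subseteq> tuples V (Suc j); \<And>xs. xs \<in> X \<Longrightarrow> compatible R xs xs;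
      c / 2 ^ k * real (card V) ^ Suc j \<le> card X; real m \<le> c ^ (1 + j * (k + 3) + j\<^sup>2) * L\<rbrakk>
    \<Longrightarrow> \<exists>F \<subseteq> X. card F = m \<and> joint R F"
proof (induction j arbitrary: k X m)
  have Lpos: "0 < L" using L(2) c by (smt (verit) mult_nonneg_nonpos zero_le_power)
  have c1: "c \<le> 1" using c by simp
  have n: "real (card V) = exp L" using L(1) Lpos
    by (metis exp_ln ln_0 of_nat_0_le_iff order_le_less order_less_irrefl)
  have ne: "V \<noteq> {}" using n by auto
  \<comment> \<open>Any loss \<open>c ^ i\<close> with \<open>i \<le> r\<^sup>2\<close> can be paid
    for by one factor \<open>L\<close>.\<close>
  have cpow: "1 \<le> c ^ i * L" if "i \<le> r\<^sup>2" for i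
  proof -
    have "c ^ (r\<^sup>2) * L \<le> c ^ i * L"
      using that c c1 Lpos by (intro mult_right_mono power_decreasing) auto
    then show ?thesis using L(2) by linarith
  qed
  {
    case 0
    have "Suc k \<le> r" using 0(2) by simp
    also have "r \<le> r\<^sup>2" by (simp add: power2_eq_square)
    finally have "1 \<le> c ^ Suc k * L" by (rule cpow)
    also have "\<dots> \<le> c / 2 ^ k * L"
      by (rule mult_right_mono[OF dyadic_density_ge]) (use c Lpos in auto)
    finally have big: "1 \<le> c / 2 ^ k * L" .
    have "real m \<le> L" using 0(6) c Lpos
      by (simp, smt (verit) mult_less_cancel_right1)
    also have "L \<le> c / 2 ^ k * L * L" using mult_right_mono[OF big, of L] Lpos by simp
    also have "\<dots> = c / 2 ^ k * (L * L)" by simp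
    also have "\<dots> \<le> c / 2 ^ k * (exp (L / 2) * exp (L / 2))"
      by (intro mult_left_mono mult_mono le_exp_half) (use c Lpos in auto)
    also have "exp (L / 2) * exp (L / 2) = exp L" by (simp flip: exp_add)
    finally have "real m \<le> c / 2 ^ k * exp L" .
    then have "m \<le> card X" using 0(5) n by simp
    then obtain F where F: "F \<subseteq> X" "card F = m" by (metis obtain_subset_with_card_n)
    \<comment> \<open>Tuples of length 1 have no two different positions, so being joint reduces to
      being distinct.\<close>
    have "length xs = 1" if "xs \<in> F" for xs using that F(1) 0(3) by (auto simp: tuples_def)
    then have "joint R F"
      by (simp add: joint_def compatible_def) (metis length_0_conv length_Suc_conv nth_Cons_0)
    then show ?case using F by blast
  next
    case (Suc j)
    show ?case
    proof (cases "m = 0")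
      case True
      then show ?thesis by (intro exI[of _ "{}"]) (simp add: joint_def)
    next
      case False
      define \<delta> where "\<delta> = c / 2 ^ Suc k"
      have \<delta>pos: "0 < \<delta>" and \<delta>2: "2 * \<delta> = c / 2 ^ k" using c by (auto simp: \<delta>_def)
      have "c / 2 ^ k \<le> c / 1" by (rule divide_left_mono) (use c in auto)
      with \<delta>pos \<delta>2 c have \<delta>: "0 < \<delta>" "\<delta> \<le> 1" by linarith+
      let ?Y = "rich_prefixes V (Suc j) X \<delta>"
      \<comment> \<open>The prefix family must have \<open>m'\<close> members so that
        \<open>m\<close> of them share many extensions.\<close>
      define m' where "m' = nat \<lfloor>real m * 2 / \<delta>\<rfloor>"
      have m': "real m' \<le> real m * 2 / \<delta>" "0 < m'" "real m - 1 \<le> \<delta> / 2 * real m'"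
        using floor_quotient_bound[of \<delta> m] \<delta> False by (auto simp: m'_def)
      have \<delta>lower: "c ^ (k + 3) \<le> \<delta> / 2"
        using dyadic_density_ge[OF c, of "k + 2"] by (simp add: \<delta>_def eval_nat_numeral)
      have "real m' * c ^ (k + 3) \<le> real m * 2 / \<delta> * (\<delta> / 2)"
        by (rule mult_mono) (use m' \<delta> \<delta>lower c in auto)
      also have "\<dots> = real m" using \<delta> by simp
      also have "\<dots> \<le> c ^ (1 + Suc j * (k + 3) + (Suc j)\<^sup>2) * L" using Suc.prems by simp
      \<comment> \<open>The exponent before this step exceeds the one after it by
        \<open>j + 1\<close>, and \<open>c \<le> 1\<close>.\<close>
      also have "\<dots> \<le> c ^ (1 + j * (Suc k + 3) + j\<^sup>2 + (k + 3)) * L"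
        by (intro mult_right_mono power_decreasing)
          (use c Lpos in \<open>auto simp: power2_eq_square algebra_simps\<close>)
      finally have "real m' * c ^ (k + 3) \<le> (c ^ (1 + j * (Suc k + 3) + j\<^sup>2) * L) * c ^ (k + 3)"
        by (simp only: power_add mult_ac)
      then have m'_le: "real m' \<le> c ^ (1 + j * (Suc k + 3) + j\<^sup>2) * L"
        by (rule mult_right_le_imp_le) (use c in simp)
      have "\<exists>F\<subseteq>?Y. card F = m' \<and> joint R F"
      proof (rule Suc.IH)
        show "1 \<le> Suc k" "Suc j + Suc k \<le> r" using Suc.prems by auto
        show "?Y \<subseteq> tuples V (Suc j)" by (auto simp: rich_prefixes_def)
        show "compatible R xs xs" if "xs \<in> ?Y" for xs
          using rich_prefix_compatible[OF ne V \<delta>(1) Suc.prems(4) that] .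
        show "c / 2 ^ Suc k * real (card V) ^ Suc j \<le> card ?Y"
          using card_rich_prefixes[OF V ne _ Suc.prems(3), of \<delta>] \<delta> \<delta>2 Suc.prems(5)
          by (simp add: \<delta>_def)
      qed (rule m'_le)
      then obtain F where F: "F \<subseteq> ?Y" "card F = m'" "joint R F" by blast
      have "F \<noteq> {}" using F(2) m'(2) by auto
      from joint_large_extension[OF V ne F(1) this \<delta>(1), of m] m'(3) F(2)
      obtain S T where S: "S \<subseteq> F" "card S = m" and T: "T \<subseteq> V"
        and ST: "\<And>xs v. xs \<in> S \<Longrightarrow> v \<in> T \<Longrightarrow> xs @ [v] \<in> X"
        and large: "\<delta> / 2 * card V \<le> real (card T) * 2 ^ m'" by auto
      have r3: "3 \<le> r" using Suc.prems by simp
      have "3 * r \<le> r\<^sup>2" using r3 by (simp add: power2_eq_square)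
      then have r2: "k + 3 \<le> r\<^sup>2" "9 \<le> r\<^sup>2" using Suc.prems(2) r3 by auto
      \<comment> \<open>Here \<open>3 \<le> r\<close>, which gives \<open>512 \<le> L\<close>, more
        than \<open>le_exp_quarter\<close> asks for.\<close>
      have "1 \<le> c ^ 9 * L" by (rule cpow) (rule r2)
      also have "\<dots> \<le> (1/2) ^ 9 * L" by (intro mult_right_mono power_mono) (use c Lpos in auto)
      finally have L24: "24 \<le> L" by (simp add: field_simps)
      \<comment> \<open>Since \<open>m' \<le> L / 2\<close>, pigeonhole divides by at most the
        square root of \<open>card V\<close>, and \<open>T\<close> keeps at least
        \<open>\<delta> / 2\<close> times that root.\<close>
      note m'_le
      also have "c ^ (1 + j * (Suc k + 3) + j\<^sup>2) * L \<le> c ^ 1 * L"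
        by (intro mult_right_mono power_decreasing) (use c c1 Lpos in auto)
      also have "\<dots> \<le> L / 2" using mult_right_mono[OF c(2), of L] Lpos by simp
      finally have "7 / 10 * real m' \<le> L / 2" by linarith
      then have pow: "2 ^ m' \<le> exp (L / 2)"
        using two_power_le_exp[of m'] by (meson exp_le_cancel_iff order_trans)
      \<comment> \<open>It remains to compare \<open>m \<le> L\<close> with this bound: one extra
        factor \<open>L\<close> cancels \<open>\<delta> / 2\<close>, and
        \<open>L * L \<le> exp (L / 2)\<close>. Then \<open>T\<close> has room for distinct last
        coordinates.\<close>
      have "c ^ (1 + Suc j * (k + 3) + (Suc j)\<^sup>2) \<le> 1" using c by (intro power_le_one) auto
      then have "real m \<le> 1 * L" using Suc.prems(6) Lpos by (meson mult_right_mono order_trans less_imp_le)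
      also have "1 * L \<le> (c ^ (k + 3) * L) * L" using cpow[OF r2(1)] Lpos
        by (intro mult_right_mono) auto
      also have "\<dots> \<le> \<delta> / 2 * (L * L)"
        using mult_right_mono[OF \<delta>lower, of "L * L"] Lpos by (simp add: mult.assoc)
      also have "\<dots> \<le> \<delta> / 2 * (exp (L / 4) * exp (L / 4))"
        by (intro mult_left_mono mult_mono le_exp_quarter) (use L24 \<delta> in auto)
      also have "exp (L / 4) * exp (L / 4) = exp (L / 2)" by (simp flip: exp_add)
      finally have "real m * exp (L / 2) \<le> \<delta> / 2 * exp (L / 2) * exp (L / 2)"
        by (intro mult_right_mono) auto
      also have "\<dots> = \<delta> / 2 * exp L" by (simp add: mult.assoc flip: exp_add)
      also have "\<dots> \<le> real (card T) * 2 ^ m'" using large n by simp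
      also have "\<dots> \<le> real (card T) * exp (L / 2)" by (intro mult_left_mono pow) auto
      finally have "m \<le> card T" by simp
      moreover have "finite S" using S(2) False card_ge_0_finite by blast
      moreover have "finite T" using T V finite_subset by blast
      ultimately obtain g where g: "inj_on g S" "g ` S \<subseteq> T"
        using S(2) by (metis card_le_inj)
      let ?F = "(\<lambda>xs. xs @ [g xs]) ` S"
      have "?F \<subseteq> X" using ST g(2) by blast
      moreover have "card ?F = m" using S(2) by (subst card_image) (auto simp: inj_on_def)
      moreover have "joint R ?F"
      proof (rule joint_append_distinct[OF joint_subset[OF F(3) S(1)] _ _ g])
        show "S \<subseteq> tuples V (Suc j)" using S(1) F(1) by (auto simp: rich_prefixes_def)
        show "compatible R (xs @ [v]) (xs @ [v])" if "xs \<in> S" "v \<in> T" for xs v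
          using Suc.prems(4) ST that by blast
      qed
      ultimately show ?thesis by blast
    qed
  }
qed

section \<open>Size of the large class\<close>

text \<open>After exponentiation this says that \<open>c / 4 * n\<close>, divided by the bound
  \<open>exp (7 / 10 * m)\<close> for \<open>2 ^ m\<close>, still exceeds
  \<open>n powr (1 - c ^ (r - 1))\<close>. With \<open>u = 1 / c\<close> and
  \<open>y = c ^ (r - 1) * L\<close>, one has \<open>u ^ 3 \<le> y\<close> and
  \<open>m \<le> 4 * c\<^sup>2 * y\<close>, while \<open>ln (4 / c)\<close> grows at most linearly
  in \<open>u\<close>.\<close>

lemma last_class_exponent:
  fixes c L :: real
  assumes r: "2 \<le> r" and c: "0 < c" "c \<le> 1/2" and L: "1 \<le> c ^ (r\<^sup>2) * L"
    and m: "real m \<le> 4 / c * (c ^ (r\<^sup>2) * L)"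
  shows "ln (4 / c) + 7 / 10 * real m < c ^ (r - 1) * L"
proof -
  define y where "y = c ^ (r - 1) * L"
  have Lpos: "0 < L" using L c by (smt (verit) mult_nonneg_nonpos zero_le_power)
  then have y0: "0 < y" using c by (simp add: y_def)
  \<comment> \<open>The subtraction is not truncated because \<open>2 \<le> r\<close>; the remainder
    is 0 for \<open>r = 2\<close>.\<close>
  have rr: "r\<^sup>2 = (r - 1) + 3 + (r * r - r - 2)"
  proof -
    obtain q where "r = q + 2" using r by (metis add.commute le_Suc_ex)
    then show ?thesis by (simp add: power2_eq_square)
  qed
  have "c ^ (r\<^sup>2) * L = y * c ^ 3 * c ^ (r * r - r - 2)"
    unfolding rr power_add y_def by (simp add: mult_ac)
  also have "\<dots> \<le> y * c ^ 3 * 1"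
    by (intro mult_left_mono power_le_one) (use c y0 in auto)
  finally have top: "c ^ (r\<^sup>2) * L \<le> y * c ^ 3" by simp
  define u where "u = 1 / c"
  have u: "2 \<le> u" "c * u = 1" using c by (auto simp: u_def field_simps)
  have "1 * u ^ 3 \<le> y * c ^ 3 * u ^ 3" using top L u by (intro mult_right_mono) auto
  also have "\<dots> = y" using u by (simp add: mult.assoc flip: power_mult_distrib)
  finally have yu: "u ^ 3 \<le> y" by simp
  have "real m \<le> 4 / c * (y * c ^ 3)"
    using m mult_left_mono[OF top, of "4 / c"] c by simp
  also have "\<dots> = 4 * c\<^sup>2 * y" using c by (simp add: power2_eq_square power3_eq_cube)
  finally have m2: "7 / 10 * real m \<le> 28 / 10 * c\<^sup>2 * y" by (simp add: mult_ac)
  \<comment> \<open>Splitting off 8 leaves \<open>u / 2\<close>, where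
    \<open>ln x \<le> x - 1\<close> is sharp at the extreme case \<open>c = 1/2\<close>.\<close>
  have "ln (4 / c) = ln (2 * 2 * 2 * (u / 2))" by (simp add: u_def)
  also have "\<dots> = ln (2 * 2 * 2) + ln (u / 2)" using u by (intro ln_mult_pos) auto
  also have "ln (2 * 2 * 2 :: real) = 3 * ln 2"
    using ln_realpow[of 2 3] by simp
  also have "3 * ln 2 + ln (u / 2) \<le> 3 * (7 / 10) + (u / 2 - 1)"
  proof (intro add_mono mult_left_mono ln_le_minus_one)
    show "ln 2 \<le> (7 / 10 :: real)" using ln_mono[OF two_le_exp] by simp
  qed (use u in auto)
  finally have lnb: "ln (4 / c) \<le> u / 2 + 11 / 10" by simp
  have c2: "c\<^sup>2 \<le> (1/2)\<^sup>2" by (rule power_mono) (use c in auto)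
  have "u ^ 3 * (1 - 28 / 10 * c\<^sup>2) \<le> y * (1 - 28 / 10 * c\<^sup>2)"
    by (rule mult_right_mono[OF yu]) (use c2 in \<open>simp add: power2_eq_square\<close>)
  moreover have "u ^ 3 * c\<^sup>2 = u"
    using u by (simp add: power2_eq_square power3_eq_cube) (metis mult.assoc mult.commute mult_1)
  ultimately have "u ^ 3 - 28 / 10 * u \<le> y - 28 / 10 * c\<^sup>2 * y"
    by (simp add: algebra_simps)
  moreover have "4 * u \<le> u ^ 3"
  proof -
    have "2 * 2 * u \<le> u * u * u" using u by (intro mult_mono) auto
    then show ?thesis by (simp add: power3_eq_cube)
  qed
  ultimately show ?thesis using lnb m2 u unfolding y_def[symmetric] by linarith
qed

section \<open>Translation between induced copies, tuples and classes\<close>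

text \<open>Each copy is the set of entries of one of its enumerations, so passing to ordered tuples
  cannot lower the count. The conjunct \<open>a \<noteq> b\<close> records injectivity and later
  makes the classes disjoint.\<close>

lemma induced_copies_le_tuples:
  assumes V: "finite V"
  shows "card (induced_copies V E r EH)
    \<le> card {xs \<in> tuples V r. compatible (\<lambda>i k a b. a \<noteq> b \<and> (E a b \<longleftrightarrow> EH i k)) xs xs}"
    (is "_ \<le> card ?M")
proof -
  have "induced_copies V E r EH \<subseteq> set ` ?M"
  proof
    fix S assume "S \<in> induced_copies V E r EH"
    then obtain f where S: "S \<subseteq> V" and f: "bij_betw f {0..<r} S"
      "\<forall>i<r. \<forall>j<r. i \<noteq> j \<longrightarrow> (E (f i) (f j) \<longleftrightarrow> EH i j)"
      by (auto simp: induced_copies_def)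
    have "set (map f [0..<r]) = S" using f(1) by (auto simp: bij_betw_def)
    moreover have "f i \<noteq> f k" if "i < r" "k < r" "i \<noteq> k" for i k
      using f(1) that by (auto simp: bij_betw_def dest: inj_onD)
    then have "map f [0..<r] \<in> ?M"
      using calculation S f(2) by (simp add: tuples_def compatible_def)
    ultimately show "S \<in> set ` ?M" by blast
  qed
  then have "card (induced_copies V E r EH) \<le> card (set ` ?M)"
    by (rule card_mono[rotated]) (simp add: finite_tuples[OF V])
  also have "\<dots> \<le> card ?M" by (rule card_image_le) (simp add: finite_tuples[OF V])
  finally show ?thesis .
qed

text \<open>The first \<open>r - 1\<close> classes are the coordinate sets of \<open>S\<close> and
  the last is \<open>T\<close>. Pairs among the former are governed by \<open>joint\<close>, pairs
  involving \<open>T\<close> by the common extensions.\<close>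

lemma has_induced_type_joint:
  assumes V: "finite V" and S: "S \<subseteq> tuples V (r - 1)" "card S = s" and T: "T \<subseteq> V"
    and joint: "joint (\<lambda>i k a b. a \<noteq> b \<and> (E a b \<longleftrightarrow> EH i k)) S"
    and ST: "\<And>xs v. xs \<in> S \<Longrightarrow> v \<in> T \<Longrightarrow>
      compatible (\<lambda>i k a b. a \<noteq> b \<and> (E a b \<longleftrightarrow> EH i k)) (xs @ [v]) (xs @ [v])"
  shows "has_induced_type V E r EH (\<lambda>i. if i = r - 1 then card T else s)"
proof -
  let ?R = "\<lambda>i k a b. a \<noteq> b \<and> (E a b \<longleftrightarrow> EH i k)"
  define U where "U i = (if i = r - 1 then T else (\<lambda>xs. xs ! i) ` S)" for i
  have len: "length xs = r - 1" if "xs \<in> S" for xs using S(1) that by (auto simp: tuples_def)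
  have R: "?R i k a b" if "i < r" "k < r" "i \<noteq> k" "a \<in> U i" "b \<in> U k" for i k a b
  proof -
    have "i < r - 1 \<or> i = r - 1" "k < r - 1 \<or> k = r - 1" using that(1,2) by auto
    then consider "i < r - 1" "k < r - 1" | "i = r - 1" "k < r - 1" | "i < r - 1" "k = r - 1"
      using \<open>i \<noteq> k\<close> by blast
    then show ?thesis
    proof cases
      case 1
      then show ?thesis using that joint len by (auto simp: U_def joint_def compatible_def)
    next
      case 2
      with that obtain xs where xs: "xs \<in> S" "b = xs ! k" "a \<in> T" by (auto simp: U_def)
      with ST have "compatible ?R (xs @ [a]) (xs @ [a])" by blast
      then have "?R i k ((xs @ [a]) ! i) ((xs @ [a]) ! k)"
        unfolding compatible_def using 2 len[OF xs(1)] by auto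
      then show ?thesis using 2 xs len[OF xs(1)] by (simp add: nth_append)
    next
      case 3
      with that obtain xs where xs: "xs \<in> S" "a = xs ! i" "b \<in> T" by (auto simp: U_def)
      with ST have "compatible ?R (xs @ [b]) (xs @ [b])" by blast
      then have "?R i k ((xs @ [b]) ! i) ((xs @ [b]) ! k)"
        unfolding compatible_def using 3 len[OF xs(1)] by auto
      then show ?thesis using 3 xs len[OF xs(1)] by (simp add: nth_append)
    qed
  qed
  have sub: "U i \<subseteq> V" if "i < r" for i
    using that S(1) T by (auto simp: U_def tuples_def subset_iff)
  moreover have "card (U i) = (if i = r - 1 then card T else s)" if "i < r" for i
  proof (cases "i = r - 1")
    case False
    have "inj_on (\<lambda>xs. xs ! i) S"
    proof (rule inj_onI, rule ccontr)
      fix xs ys assume "xs \<in> S" "ys \<in> S" "xs ! i = ys ! i" "xs \<noteq> ys"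
      then show False using joint len[of xs] that False by (auto simp: joint_def)
    qed
    then show ?thesis using False S(2) by (simp add: U_def card_image)
  qed (simp add: U_def)
  moreover have "finite (U i)" if "i < r" for i using sub[OF that] V by (rule finite_subset)
  moreover have "U i \<inter> U k = {}" if "i < r" "k < r" "i \<noteq> k" for i k
    using R[OF that] by blast
  moreover have "\<forall>a\<in>U i. \<forall>b\<in>U k. E a b \<longleftrightarrow> EH i k" if "i < r" "k < r" "i \<noteq> k" for i k
    using R[OF that] by blast
  ultimately show ?thesis unfolding has_induced_type_def by (intro exI[of _ U]) simp
qed

theorem theorem2:
  fixes r n :: nat and c :: real and V :: "'a set" and E :: "'a \<Rightarrow> 'a \<Rightarrow> bool"
    and EH :: "nat \<Rightarrow> nat \<Rightarrow> bool"
  assumes "r \<ge> 2" and "0 < c" and "c \<le> 1/2"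
    and "simple_graph {0..<r} EH"
    and "simple_graph V E" and "card V = n"
    and "real (card (induced_copies V E r EH)) > c * real n ^ r"
  shows "\<exists>t::nat. real t > real n powr (1 - c ^ (r - 1)) \<and>
           has_induced_type V E r EH
             (\<lambda>i. if i = r - 1 then t else nat \<lfloor>c ^ (r^2) * ln (real n)\<rfloor>)"
proof -
  let ?R = "\<lambda>i k a b. a \<noteq> b \<and> (E a b \<longleftrightarrow> EH i k)"
  define M where "M = {xs \<in> tuples V r. compatible ?R xs xs}"
  define L where "L = ln (real n)"
  define s where "s = nat \<lfloor>c ^ (r\<^sup>2) * L\<rfloor>"
  have V: "finite V" using assms by (simp add: simple_graph_def)
  have M: "c * real n ^ r \<le> card M" "M \<noteq> {}"
  proof -
    have "real (card (induced_copies V E r EH)) \<le> card M"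
      using induced_copies_le_tuples[OF V, of E r EH] by (simp add: M_def)
    then show 1: "c * real n ^ r \<le> card M" using assms by linarith
    have "0 \<le> c * real n ^ r" using assms by simp
    then show "M \<noteq> {}"
      using assms(7) \<open>real (card (induced_copies V E r EH)) \<le> card M\<close> by auto
  qed
  \<comment> \<open>A copy has two distinct vertices because \<open>2 \<le> r\<close>.\<close>
  have n2: "2 \<le> n"
  proof -
    from M(2) obtain xs where xs: "set xs \<subseteq> V" "length xs = r" "compatible ?R xs xs"
      by (auto simp: M_def tuples_def)
    then have "xs ! 0 \<noteq> xs ! 1" "{xs ! 0, xs ! 1} \<subseteq> V"
      using assms(1) by (auto simp: compatible_def subset_iff)
    then show ?thesis using V assms(6) card_mono[OF V, of "{xs ! 0, xs ! 1}"] by simp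
  qed
  have n: "real n = exp L" using n2 by (simp add: L_def)
  have cpos: "0 < c ^ (r - 1)" using assms by simp
  show ?thesis
  proof (cases "s = 0")
    \<comment> \<open>With \<open>s = 0\<close> the small classes are empty and \<open>V\<close>
      itself is the large class.\<close>
    case True
    have "real n powr (1 - c ^ (r - 1)) < real n powr 1"
      by (rule powr_less_mono) (use n2 cpos in auto)
    moreover have "has_induced_type V E r EH (\<lambda>i. if i = r - 1 then n else 0)"
      unfolding has_induced_type_def
      by (intro exI[of _ "\<lambda>i. if i = r - 1 then V else {}"]) (use V assms(6) in auto)
    moreover have "nat \<lfloor>c ^ (r^2) * ln (real n)\<rfloor> = 0" using True unfolding s_def L_def .
    ultimately show ?thesis using n2 by (intro exI[of _ n]) (simp only:, simp)
  next
    case False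
    then have s1: "1 \<le> c ^ (r\<^sup>2) * L" "real s \<le> c ^ (r\<^sup>2) * L" unfolding s_def by linarith+
    have Lpos: "0 < L" using n2 by (simp add: L_def)
    define \<delta> where "\<delta> = c / 2"
    have \<delta>: "0 < \<delta>" "\<delta> \<le> 1" using assms by (auto simp: \<delta>_def)
    define m where "m = nat \<lfloor>real s * 2 / \<delta>\<rfloor>"
    have m: "real m \<le> real s * 2 / \<delta>" "0 < m" "real s - 1 \<le> \<delta> / 2 * real m"
      using floor_quotient_bound[of \<delta> s] \<delta> False by (auto simp: m_def)
    have "real m \<le> 4 / c * real s" using m(1) by (simp add: \<delta>_def mult.commute)
    also have "\<dots> \<le> 4 / c * (c ^ (r\<^sup>2) * L)" by (intro mult_left_mono s1) (use assms in auto)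
    finally have m_le: "real m \<le> 4 / c * (c ^ (r\<^sup>2) * L)" .
    obtain j where j: "r = Suc (Suc j)" using assms(1) by (metis Suc_le_D numeral_2_eq_2 Suc_le_mono)
    have ne: "V \<noteq> {}" using n2 assms(6) by auto
    let ?Y = "rich_prefixes V (Suc j) M \<delta>"
    have "\<exists>F\<subseteq>?Y. card F = m \<and> joint ?R F"
    proof (rule joint_exists[OF V assms(2,3), where r = r and k = 1 and j = j])
      show "L = ln (card V)" using assms(6) by (simp add: L_def)
      show "compatible ?R xs xs" if "xs \<in> ?Y" for xs
        by (rule rich_prefix_compatible[OF ne V \<delta>(1) _ that]) (simp add: M_def)
      show "c / 2 ^ 1 * real (card V) ^ Suc j \<le> card ?Y"
      proof -
        have "2 * \<delta> * real (card V) ^ Suc (Suc j) \<le> card M"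
          using M(1) assms(6) by (simp add: \<delta>_def flip: j)
        moreover have "M \<subseteq> tuples V (Suc (Suc j))" by (auto simp: M_def j)
        ultimately show ?thesis
          using card_rich_prefixes[OF V ne, of \<delta> M "Suc j"] \<delta> by (simp add: \<delta>_def)
      qed
      \<comment> \<open>The factor \<open>4 / c\<close> from the choice of \<open>m\<close> is
        absorbed by the three spare powers of \<open>c\<close>, since
        \<open>4 * c\<^sup>2 \<le> 1\<close>.\<close>
      have "r\<^sup>2 = (1 + j * (1 + 3) + j\<^sup>2) + 3" by (simp add: j power2_eq_square)
      then have "4 / c * (c ^ (r\<^sup>2) * L) = 4 * c\<^sup>2 * (c ^ (1 + j * (1 + 3) + j\<^sup>2) * L)"
        using assms(2) by (simp only: power_add) (simp add: power2_eq_square power3_eq_cube)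
      also have "\<dots> \<le> 1 * (c ^ (1 + j * (1 + 3) + j\<^sup>2) * L)"
      proof (rule mult_right_mono)
        have "c\<^sup>2 \<le> (1/2)\<^sup>2" by (rule power_mono) (use assms in auto)
        then show "4 * c\<^sup>2 \<le> 1" by (simp add: power2_eq_square)
      qed (use assms Lpos in simp)
      finally show "real m \<le> c ^ (1 + j * (1 + 3) + j\<^sup>2) * L" using m_le by simp
    qed (use s1 j in \<open>auto simp: rich_prefixes_def\<close>)
    then obtain F where F: "F \<subseteq> ?Y" "card F = m" "joint ?R F" by blast
    have "F \<noteq> {}" using F(2) m(2) by auto
    from joint_large_extension[OF V ne F(1) this \<delta>(1), of s] m(3) F(2)
    obtain S T where S: "S \<subseteq> F" "card S = s" and T: "T \<subseteq> V"
      and ST: "\<And>xs v. xs \<in> S \<Longrightarrow> v \<in> T \<Longrightarrow> xs @ [v] \<in> M"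
      and large: "\<delta> / 2 * card V \<le> real (card T) * 2 ^ m" by auto
    have "has_induced_type V E r EH (\<lambda>i. if i = r - 1 then card T else s)"
    proof (rule has_induced_type_joint)
      show "S \<subseteq> tuples V (r - 1)" using S(1) F(1) j by (auto simp: rich_prefixes_def)
      show "joint ?R S" by (rule joint_subset[OF F(3) S(1)])
      show "compatible ?R (xs @ [v]) (xs @ [v])" if "xs \<in> S" "v \<in> T" for xs v
        using ST[OF that] by (simp add: M_def)
    qed (use assms V S T False in auto)
    \<comment> \<open>Here \<open>\<delta> / 2 = c / 4\<close>, so \<open>large\<close> bounds
      \<open>card T\<close> below by \<open>c / 4 * n / 2 ^ m\<close>, the quantity controlled by
      \<open>last_class_exponent\<close>.\<close>
    moreover have "real n powr (1 - c ^ (r - 1)) < card T"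
    proof -
      have "real n powr (1 - c ^ (r - 1)) = exp (L - c ^ (r - 1) * L)"
        using n by (simp add: powr_def algebra_simps)
      also have "\<dots> < exp (L - ln (4 / c) - 7 / 10 * real m)"
        using last_class_exponent[OF assms(1-3) s1(1) m_le] by simp
      also have "\<dots> = (c / 4 * exp L) / exp (7 / 10 * real m)"
        using assms(2) by (simp add: exp_diff)
      also have "\<dots> \<le> (real (card T) * 2 ^ m) / exp (7 / 10 * real m)"
        using large n assms(6) by (intro divide_right_mono) (auto simp: \<delta>_def)
      also have "\<dots> \<le> (real (card T) * exp (7 / 10 * real m)) / exp (7 / 10 * real m)"
        by (intro divide_right_mono mult_left_mono two_power_le_exp) auto
      finally show ?thesis by simp
    qed
    ultimately show ?thesis unfolding s_def L_def by blast
  qed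
qed

end
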